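(* Let $k_0\in\mathbb Z$ and let $(x,y)\in\mathbb R^2$ satisfy $-2k_0\pi+2<x<-2(k_0-1)\pi-2$. Then all the functions below are defined at the indicated points and $$\left(\cosh^2\!\big(f^0_{\mathrm{Dil.Cat}}\big)\prod_{k\neq 0}\frac{\cosh^2\!\big(f^k_{\mathrm{Dil.Cat}}\big)}{\pi^2k^2}\right)\Bigg|_{(x,y)}+\left(\cosh^2\!\big(f^0_{\mathrm{Dil.Cat}}\big)\prod_{k\neq 0}\frac{\cosh^2\!\big(f^k_{\mathrm{Dil.Cat}}\big)}{\pi^2k^2}\right)\Bigg|_{(x,0)}=\cosh^2\!\left(\frac{f_{\mathrm{ScherkTower}}(x,y)}{\sqrt2}\right).$$
   Context: The dilated catenoids are the graphs of $$f^k_{\mathrm{Dil.Cat}}(x,y)=\cosh^{-1}\Big[\sqrt{\left(\tfrac x2+k\pi\right)^2+\left(\tfrac y{\sqrt2}\right)^2}\Big]\quad(k\in\mathbb Z),$$ and Scherk's tower is the graph of $$f_{\mathrm{ScherkTower}}(x,y)=\sqrt2\,\cosh^{-1}\Big[\sqrt{\sinh^2\!\left(\tfrac y{\sqrt2}\right)+2\sin^2\!\left(\tfrac x2\right)}\Big].$$ Here $\cosh^{-1}:[1,\infty)\to[0,\infty)$, and each function is defined where the argument of $\cosh^{-1}$ is at least $1$. The products over $k\neq0$ run over all nonzero integers and are understood as limits of the symmetric partial products $\prod_{0<|k|\le N}$ as $N\to\infty$. *)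

theory Defs
  imports Complex_Main
begin

text \<open>
  The graph functions are partial, so each comes with its domain: the set of points where the
  argument of \<open>arcosh\<close> is at least 1. The values off the domain are irrelevant.
\<close>

definition dil_cat_arg :: "int \<Rightarrow> real \<Rightarrow> real \<Rightarrow> real" where
  "dil_cat_arg k x y = sqrt ((x / 2 + of_int k * pi)\<^sup>2 + (y / sqrt 2)\<^sup>2)"

definition dil_cat_dom :: "int \<Rightarrow> (real \<times> real) set" where
  "dil_cat_dom k = {(x, y). dil_cat_arg k x y \<ge> 1}"

definition dil_cat :: "int \<Rightarrow> real \<Rightarrow> real \<Rightarrow> real" where
  "dil_cat k x y = arcosh (dil_cat_arg k x y)"

definition scherk_tower_arg :: "real \<Rightarrow> real \<Rightarrow> real" where
  "scherk_tower_arg x y = sqrt ((sinh (y / sqrt 2))\<^sup>2 + 2 * (sin (x / 2))\<^sup>2)"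

definition scherk_tower_dom :: "(real \<times> real) set" where
  "scherk_tower_dom = {(x, y). scherk_tower_arg x y \<ge> 1}"

definition scherk_tower :: "real \<Rightarrow> real \<Rightarrow> real" where
  "scherk_tower x y = sqrt 2 * arcosh (scherk_tower_arg x y)"

definition sym_partial_prod :: "(int \<Rightarrow> real) \<Rightarrow> nat \<Rightarrow> real" where
  "sym_partial_prod a N = (\<Prod>k | 0 < \<bar>k\<bar> \<and> \<bar>k\<bar> \<le> int N. a k)"

text \<open>Meaningful only if the symmetric partial products converge.\<close>

definition sym_prod :: "(int \<Rightarrow> real) \<Rightarrow> real" where
  "sym_prod a = lim (sym_partial_prod a)"

definition dil_cat_factor :: "real \<Rightarrow> real \<Rightarrow> int \<Rightarrow> real" where
  "dil_cat_factor x y k = (cosh (dil_cat k x y))\<^sup>2 / (pi\<^sup>2 * (of_int k)\<^sup>2)"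

end

(*
  With z = x/2 + i y/sqrt 2, the square of cosh of the k-th dilated catenoid is |z + k pi|^2.
  Pairing k with -k turns the product into the squared modulus of Euler's product for sin z, and
  |sin z|^2 = sin^2 (x/2) + sinh^2 (y/sqrt 2). The hypothesis keeps x/2 at distance more than 1 > pi/4
  from the multiples of pi, which puts all points in the domains.
*)
theory Submission
  imports Defs "HOL-Analysis.Gamma_Function"
begin

text \<open>Groups each \<open>k\<close> with \<open>- k\<close>, the form in which the factors of
  Euler's sine product appear.\<close>

lemma sym_partial_prod_eq:
  "sym_partial_prod a N = (\<Prod>k=1..N. a (int k) * a (- int k))"
proof -
  have "{k. 0 < \<bar>k\<bar> \<and> \<bar>k\<bar> \<le> int N} = int ` {1..N} \<union> (\<lambda>k. - int k) ` {1..N}"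
  proof (intro set_eqI iffI)
    fix k assume "k \<in> {k. 0 < \<bar>k\<bar> \<and> \<bar>k\<bar> \<le> int N}"
    then have "k = int (nat \<bar>k\<bar>) \<or> k = - int (nat \<bar>k\<bar>)" "nat \<bar>k\<bar> \<in> {1..N}"
      by auto
    then show "k \<in> int ` {1..N} \<union> (\<lambda>k. - int k) ` {1..N}"
      by blast
  qed auto
  moreover have "prod a (int ` {1..N} \<union> (\<lambda>k. - int k) ` {1..N})
      = prod a (int ` {1..N}) * prod a ((\<lambda>k. - int k) ` {1..N})"
    by (rule prod.union_disjoint) auto
  ultimately show ?thesis
    by (simp add: sym_partial_prod_def prod.reindex inj_on_def prod.distrib)
qed

text \<open>Rests on (z + k pi)(z - k pi) = z^2 - k^2 pi^2; dividing by -(k pi)^2 gives the Euler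
  factor, and the modulus absorbs the sign.\<close>

lemma Euler_factor_sym:
  fixes z :: complex
  assumes "k \<noteq> 0"
  shows "(cmod (z + of_real (of_int (int k) * pi)))\<^sup>2 / (pi\<^sup>2 * (of_int (int k))\<^sup>2)
       * ((cmod (z + of_real (of_int (- int k) * pi)))\<^sup>2 / (pi\<^sup>2 * (of_int (- int k))\<^sup>2))
    = (cmod (1 - (z / of_real pi)\<^sup>2 / of_nat k^2))\<^sup>2"
proof -
  have eq: "1 - (z / of_real pi)\<^sup>2 / of_nat k^2
     = - ((z + of_real (of_int (int k) * pi)) * (z + of_real (of_int (- int k) * pi)))
         / of_real (pi * real k)^2"
    using assms by (simp add: field_simps power2_eq_square)
  show ?thesis
    unfolding eq using assms
    by (simp add: norm_mult norm_divide norm_power power_divide power_mult_distrib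
        power2_eq_square power4_eq_xxxx mult_ac)
qed

lemma sym_partial_prod_sin:
  fixes z :: complex
  shows "(\<lambda>N. (cmod z)\<^sup>2 * sym_partial_prod
            (\<lambda>k. (cmod (z + of_real (of_int k * pi)))\<^sup>2 / (pi\<^sup>2 * (of_int k)\<^sup>2)) N)
         \<longlonglongrightarrow> (cmod (sin z))\<^sup>2"
proof -
  let ?P = "\<lambda>N. \<Prod>k=1..N. 1 - (z / of_real pi)\<^sup>2 / of_nat k^2"
  have "sym_partial_prod (\<lambda>k. (cmod (z + of_real (of_int k * pi)))\<^sup>2 / (pi\<^sup>2 * (of_int k)\<^sup>2)) N
      = (cmod (?P N))\<^sup>2" for N
    unfolding sym_partial_prod_eq prod_norm[symmetric] prod_power_distrib
    by (intro prod.cong refl Euler_factor_sym) auto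
  \<comment> \<open>Euler's formula concerns sin (pi w), hence the choice w = z / pi; the squared
    modulus is continuous.\<close>
  moreover have "(\<lambda>N. (cmod (of_real pi * (z / of_real pi) * ?P N))\<^sup>2) \<longlonglongrightarrow> (cmod (sin z))\<^sup>2"
    using sin_product_formula_complex[of "z / of_real pi"]
    by (auto intro!: tendsto_intros)
  ultimately show ?thesis
    by (simp add: norm_mult power_mult_distrib)
qed

text \<open>After cosh^2 = 1 + sinh^2 and cos^2 = 1 - sin^2, the mixed terms sin^2 sinh^2
  cancel.\<close>

lemma norm_sin_squared_sinh:
  "(cmod (sin z))\<^sup>2 = (sin (Re z))\<^sup>2 + (sinh (Im z))\<^sup>2"
proof -
  have "Re (sin z) = sin (Re z) * cosh (Im z)" "Im (sin z) = cos (Re z) * sinh (Im z)"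
    by (simp_all add: Re_sin Im_sin cosh_def sinh_def)
  then have "(cmod (sin z))\<^sup>2
      = (sin (Re z))\<^sup>2 * (cosh (Im z))\<^sup>2 + (cos (Re z))\<^sup>2 * (sinh (Im z))\<^sup>2"
    by (simp add: cmod_power2 power_mult_distrib)
  also have "\<dots> = (sin (Re z))\<^sup>2 + (sinh (Im z))\<^sup>2"
    by (simp add: cosh_square_eq cos_squared_eq algebra_simps)
  finally show ?thesis .
qed

lemma dil_cat_arg_eq_cmod:
  "dil_cat_arg k x y = cmod (Complex (x / 2) (y / sqrt 2) + of_real (of_int k * pi))"
  by (simp add: dil_cat_arg_def cmod_def)

lemma dil_cat_sym_prod:
  assumes dom: "\<forall>k. (x, y) \<in> dil_cat_dom k"
  shows "convergent (sym_partial_prod (dil_cat_factor x y))"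
    and "(cosh (dil_cat 0 x y))\<^sup>2 * sym_prod (dil_cat_factor x y)
        = (sin (x / 2))\<^sup>2 + (sinh (y / sqrt 2))\<^sup>2"
proof -
  define z where "z = Complex (x / 2) (y / sqrt 2)"
  have arg: "dil_cat_arg k x y = cmod (z + of_real (of_int k * pi))" for k
    by (simp add: dil_cat_arg_eq_cmod z_def)
  have cosh: "cosh (dil_cat k x y) = cmod (z + of_real (of_int k * pi))" for k
    unfolding arg[symmetric] using dom by (simp add: dil_cat_def dil_cat_dom_def)
  \<comment> \<open>The domain condition for \<open>k = 0\<close> says |z| \<ge> 1, so |z|^2 can be
    divided out to isolate the limit of the partial products.\<close>
  have nz: "cmod z \<noteq> 0"
    using dom[rule_format, of 0] by (auto simp: dil_cat_dom_def arg)
  let ?L = "(sin (x / 2))\<^sup>2 + (sinh (y / sqrt 2))\<^sup>2"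
  have factor: "dil_cat_factor x y
      = (\<lambda>k. (cmod (z + of_real (of_int k * pi)))\<^sup>2 / (pi\<^sup>2 * (of_int k)\<^sup>2))"
    unfolding dil_cat_factor_def cosh ..
  have "(\<lambda>N. (cmod z)\<^sup>2 * sym_partial_prod (dil_cat_factor x y) N) \<longlonglongrightarrow> ?L"
    using sym_partial_prod_sin[of z] unfolding factor norm_sin_squared_sinh by (simp add: z_def)
  from tendsto_divide[OF this tendsto_const, of "(cmod z)\<^sup>2"]
  have lim: "sym_partial_prod (dil_cat_factor x y) \<longlonglongrightarrow> ?L / (cmod z)\<^sup>2"
    using nz by simp
  then show "convergent (sym_partial_prod (dil_cat_factor x y))"
    by (rule convergentI)
  show "(cosh (dil_cat 0 x y))\<^sup>2 * sym_prod (dil_cat_factor x y) = ?L"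
    using nz by (simp add: sym_prod_def limI[OF lim] cosh)
qed

text \<open>The horizontal distance alone suffices, so one bound on \<open>x\<close> serves the
  points at height \<open>y\<close> and at height 0.\<close>

lemma mem_dil_cat_domI:
  assumes "1 \<le> \<bar>x / 2 + of_int k * pi\<bar>"
  shows "(x, y) \<in> dil_cat_dom k"
proof -
  have "1 \<le> (x / 2 + of_int k * pi)\<^sup>2"
    using assms by (metis abs_le_square_iff abs_one one_power2)
  then have "1 \<le> (x / 2 + of_int k * pi)\<^sup>2 + (y / sqrt 2)\<^sup>2"
    using zero_le_power2[of "y / sqrt 2"] by linarith
  then show ?thesis
    by (simp add: dil_cat_dom_def dil_cat_arg_def)
qed

text \<open>For \<open>j \<ge> 0\<close> the sum is at least \<open>u > 1\<close>; for
  \<open>j \<le> -1\<close> it is at most \<open>u - pi < -1\<close>.\<close>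

lemma dist_pi_multiples_ge_1:
  fixes u :: real and j :: int
  assumes "1 < u" and "u < pi - 1"
  shows "1 \<le> \<bar>u + of_int j * pi\<bar>"
proof (cases "j \<ge> 0")
  case True
  then have "0 \<le> of_int j * pi"
    by simp
  then show ?thesis
    using assms by linarith
next
  case False
  then have "of_int j \<le> (- 1 :: real)"
    by linarith
  then have "of_int j * pi \<le> - 1 * pi"
    by (rule mult_right_mono) simp
  then show ?thesis
    using assms by linarith
qed

text \<open>Since 2 sin^2 u = 1 - cos 2u, only the sign of cos 2u matters; it equals - sin (2u -
  pi/2), whose argument lies in [0, pi].\<close>

lemma sin_squared_ge_half:
  fixes u :: real
  assumes "pi / 4 \<le> u" and "u \<le> 3 * pi / 4"
  shows "1 \<le> 2 * (sin u)\<^sup>2"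
proof -
  have "0 \<le> sin (2 * u - pi / 2)"
    using assms by (intro sin_ge_zero) auto
  then have "cos (2 * u) \<le> 0"
    by (simp add: sin_diff)
  then show ?thesis
    by (simp add: cos_double_sin)
qed

theorem proposition2p1:
  fixes k0 :: int and x y :: real
  assumes "- 2 * of_int k0 * pi + 2 < x" and "x < - 2 * (of_int k0 - 1) * pi - 2"
  shows "(\<forall>k. (x, y) \<in> dil_cat_dom k \<and> (x, 0) \<in> dil_cat_dom k)
    \<and> (x, y) \<in> scherk_tower_dom
    \<and> convergent (sym_partial_prod (dil_cat_factor x y))
    \<and> convergent (sym_partial_prod (dil_cat_factor x 0))
    \<and> (cosh (dil_cat 0 x y))\<^sup>2 * sym_prod (dil_cat_factor x y)
        + (cosh (dil_cat 0 x 0))\<^sup>2 * sym_prod (dil_cat_factor x 0)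
      = (cosh (scherk_tower x y / sqrt 2))\<^sup>2"
proof -
  \<comment> \<open>Translation by a multiple of pi moves every strip of the hypothesis to the same
    interval (1, pi - 1).\<close>
  define u where "u = x / 2 + of_int k0 * pi"
  have u: "1 < u" "u < pi - 1"
    using assms by (auto simp: u_def algebra_simps)
  have dom: "(x, v) \<in> dil_cat_dom k" for k v
    using dist_pi_multiples_ge_1[OF u, of "k - k0"]
    by (intro mem_dil_cat_domI) (simp add: u_def algebra_simps)
  \<comment> \<open>The shift by \<open>k0 * pi\<close> changes the sine at most in sign.\<close>
  have "(sin (x / 2))\<^sup>2 = (sin u)\<^sup>2"
    by (simp add: u_def sin_add power_mult_distrib mult.commute[of _ pi])
  moreover have "1 \<le> 2 * (sin u)\<^sup>2"
    \<comment> \<open>From pi < 4: pi/4 < 1 < u and u < pi - 1 < 3 pi/4.\<close>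
    using u pi_less_4 by (intro sin_squared_ge_half) auto
  ultimately have "1 \<le> (sinh (y / sqrt 2))\<^sup>2 + 2 * (sin (x / 2))\<^sup>2"
    using zero_le_power2[of "sinh (y / sqrt 2)"] by linarith
  then have arg: "1 \<le> scherk_tower_arg x y"
    and arg2: "(scherk_tower_arg x y)\<^sup>2 = (sinh (y / sqrt 2))\<^sup>2 + 2 * (sin (x / 2))\<^sup>2"
    by (simp_all add: scherk_tower_arg_def)
  have "(cosh (scherk_tower x y / sqrt 2))\<^sup>2 = (sinh (y / sqrt 2))\<^sup>2 + 2 * (sin (x / 2))\<^sup>2"
    using arg arg2 by (simp add: scherk_tower_def)
  \<comment> \<open>The product at height 0 contributes sin^2 (x/2) only, as sinh 0 = 0; this is the
    second copy of sin^2 in Scherk's tower.\<close>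
  then show ?thesis
    using dom arg dil_cat_sym_prod[of x y] dil_cat_sym_prod[of x 0]
    by (simp add: scherk_tower_dom_def)
qed

end
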